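(* Let $m,n \in \mathbb{N}$ be such that $m \geq 3$ and $m+2 \leq n \leq 2m-1$. Then $r(B(m,n)) \leq 2n+m+1$.
   Context: $\mathbb{N}$ denotes the positive integers. All graphs are finite, simple and undirected. For a graph $G$, the Ramsey number $r(G)$ is the minimum $r$ such that any $2$-coloring of the edges of the complete graph $K_r$ yields a monochromatic subgraph (not necessarily induced) isomorphic to $G$. The bistar $B(m,n)$ is the tree with exactly two non-leaf vertices (called centers), which are adjacent to each other, one of them having exactly $m$ leaf neighbors (so degree $m+1$) and the other having exactly $n$ leaf neighbors (so degree $n+1$). *)

theory Defs
  imports Complex_Main "HOL-Library.Ramsey"
begin

datatype 'a sgraph = SGraph (verts: "'a set") (edges: "'a set set")

definition simple_graph :: "'a sgraph \<Rightarrow> bool" where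
  "simple_graph G \<longleftrightarrow> finite (verts G) \<and> edges G \<subseteq> [verts G]\<^bsup>2\<^esup>"

definition adjacent :: "'a sgraph \<Rightarrow> 'a \<Rightarrow> 'a \<Rightarrow> bool" where
  "adjacent G x y \<longleftrightarrow> {x, y} \<in> edges G"

definition neighbors :: "'a sgraph \<Rightarrow> 'a \<Rightarrow> 'a set" where
  "neighbors G x = {y \<in> verts G. adjacent G x y}"

definition is_leaf :: "'a sgraph \<Rightarrow> 'a \<Rightarrow> bool" where
  "is_leaf G x \<longleftrightarrow> x \<in> verts G \<and> card (neighbors G x) = 1"

definition connected_graph :: "'a sgraph \<Rightarrow> bool" where
  "connected_graph G \<longleftrightarrow> verts G \<noteq> {} \<and>
     (\<forall>x\<in>verts G. \<forall>y\<in>verts G. (adjacent G)\<^sup>*\<^sup>* x y)"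

definition is_cycle :: "'a sgraph \<Rightarrow> 'a list \<Rightarrow> bool" where
  "is_cycle G xs \<longleftrightarrow> length xs \<ge> 3 \<and> distinct xs \<and> set xs \<subseteq> verts G \<and>
     (\<forall>i<length xs. adjacent G (xs ! i) (xs ! (Suc i mod length xs)))"

definition is_tree :: "'a sgraph \<Rightarrow> bool" where
  "is_tree G \<longleftrightarrow> simple_graph G \<and> connected_graph G \<and> (\<nexists>xs. is_cycle G xs)"

text \<open>\<open>is_bistar m n G\<close> says that \<open>G\<close> is a copy of the bistar \<open>B(m,n)\<close>, on an arbitrary vertex set;
  \<open>u\<close> and \<open>v\<close> are the two centers.\<close>

definition is_bistar :: "nat \<Rightarrow> nat \<Rightarrow> 'a sgraph \<Rightarrow> bool" where
  "is_bistar m n G \<longleftrightarrow> is_tree G \<and>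
     (\<exists>u v. u \<noteq> v \<and> {x \<in> verts G. \<not> is_leaf G x} = {u, v} \<and> adjacent G u v \<and>
            card {x \<in> neighbors G u. is_leaf G x} = m \<and>
            card {x \<in> neighbors G v. is_leaf G x} = n)"

definition subgraph :: "'a sgraph \<Rightarrow> 'a sgraph \<Rightarrow> bool" where
  "subgraph H G \<longleftrightarrow> simple_graph H \<and> verts H \<subseteq> verts G \<and> edges H \<subseteq> edges G"

definition isomorphic :: "'a sgraph \<Rightarrow> 'b sgraph \<Rightarrow> bool" where
  "isomorphic G H \<longleftrightarrow> (\<exists>f. bij_betw f (verts G) (verts H) \<and>
     (\<forall>x\<in>verts G. \<forall>y\<in>verts G. adjacent G x y \<longleftrightarrow> adjacent H (f x) (f y)))"

definition complete_graph :: "nat \<Rightarrow> nat sgraph" where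
  "complete_graph r = SGraph {..<r} ([{..<r}]\<^bsup>2\<^esup>)"

definition ramsey_arrows :: "nat \<Rightarrow> 'a sgraph \<Rightarrow> bool" where
  "ramsey_arrows r G \<longleftrightarrow>
     (\<forall>c \<in> edges (complete_graph r) \<rightarrow> {..<2::nat}.
        \<exists>H. subgraph H (complete_graph r) \<and> (\<exists>i<2. \<forall>e\<in>edges H. c e = i) \<and> isomorphic G H)"

definition ramsey_number :: "'a sgraph \<Rightarrow> nat" where
  "ramsey_number G = (LEAST r. ramsey_arrows r G)"

text \<open>Sanity check: \<open>B(m,n)\<close> exists, with centers 0 and 1.\<close>

lemma ex_is_bistar:
  assumes "m \<ge> 1" "n \<ge> 1"
  shows "\<exists>G :: nat sgraph. is_bistar m n G"
proof -
  define L where "L = {2..<m+2}"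
  define R where "R = {m+2..<m+n+2}"
  define E where "E = insert {0,1} ((\<lambda>x. {0,x}) ` L \<union> (\<lambda>x. {1,x}) ` R)"
  define G where "G = SGraph {..<m+n+2} E"
  have adj: "adjacent G x y \<longleftrightarrow> (x = 0 \<and> (y = 1 \<or> y \<in> L)) \<or> (y = 0 \<and> (x = 1 \<or> x \<in> L))
     \<or> (x = 1 \<and> y \<in> R) \<or> (y = 1 \<and> x \<in> R)" for x y
    unfolding adjacent_def G_def E_def sgraph.sel insert_iff Un_iff image_iff doubleton_eq_iff
    by blast
  have V: "verts G = {0,1} \<union> L \<union> R"
    by (auto simp: G_def L_def R_def)
  have nin: "0 \<notin> L" "1 \<notin> L" "0 \<notin> R" "1 \<notin> R" "(0::nat) \<noteq> 1"
    by (auto simp: L_def R_def)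
  have n0: "neighbors G 0 = insert 1 L"
    by (rule set_eqI) (simp add: neighbors_def V adj nin nin[simplified], blast)
  have n1: "neighbors G 1 = insert 0 R"
    by (rule set_eqI) (simp add: neighbors_def V adj nin nin[simplified], blast)
  have nL: "neighbors G x = {0}" if "x \<in> L" for x
    using that V by (auto simp: neighbors_def adj L_def R_def)
  have nR: "neighbors G x = {1}" if "x \<in> R" for x
    using that V by (auto simp: neighbors_def adj L_def R_def)
  have c0: "card (neighbors G 0) = Suc m" unfolding n0 by (simp add: L_def)
  have c1: "card (neighbors G 1) = Suc n" unfolding n1 by (simp add: R_def)
  have leaf: "is_leaf G x \<longleftrightarrow> x \<in> L \<union> R" for x
  proof (cases "x \<in> L \<union> R")
    case True then show ?thesis using V nL nR by (auto simp: is_leaf_def)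
  next
    case False
    then have "is_leaf G x \<Longrightarrow> x = 0 \<or> x = 1" using V by (auto simp: is_leaf_def)
    then show ?thesis using c0 c1 assms False by (auto simp: is_leaf_def)
  qed
  have sg: "simple_graph G"
    by (auto simp: simple_graph_def G_def E_def nsets_def L_def R_def)
  have sym: "adjacent G x y \<Longrightarrow> adjacent G y x" for x y
    by (auto simp: adj)
  have to0: "(adjacent G)\<^sup>*\<^sup>* x 0 \<and> (adjacent G)\<^sup>*\<^sup>* 0 x" if "x \<in> verts G" for x
  proof -
    have e: "adjacent G 0 1" "adjacent G 1 0" by (auto simp: adj)
    consider "x = 0" | "x = 1" | "x \<in> L" | "x \<in> R" using \<open>x \<in> verts G\<close> V by auto
    then show ?thesis
    proof cases
      case 4
      then have "adjacent G x 1" "adjacent G 1 x" by (auto simp: adj)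
      then show ?thesis using e
        by (blast intro: converse_rtranclp_into_rtranclp[OF _ r_into_rtranclp])
    next
      case 3
      then have "adjacent G x 0" "adjacent G 0 x" by (auto simp: adj)
      then show ?thesis by blast
    qed (use e in blast)+
  qed
  have conn: "connected_graph G"
    unfolding connected_graph_def
  proof (intro conjI ballI)
    show "verts G \<noteq> {}" using V by auto
    show "(adjacent G)\<^sup>*\<^sup>* x y" if "x \<in> verts G" "y \<in> verts G" for x y
      using to0[OF that(1)] to0[OF that(2)] by (auto intro: rtranclp_trans[of _ x 0 y])
  qed
  have acyc: "\<not> is_cycle G xs" for xs
  proof
    assume c: "is_cycle G xs"
    let ?k = "length xs"
    have k: "?k \<ge> 3" and d: "distinct xs" and s: "set xs \<subseteq> verts G"
      and a: "\<And>i. i < ?k \<Longrightarrow> adjacent G (xs ! i) (xs ! (Suc i mod ?k))"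
      using c by (auto simp: is_cycle_def)
    have "x \<in> {0,1}" if "x \<in> set xs" for x
    proof -
      obtain i where i: "i < ?k" "x = xs ! i" using \<open>x \<in> set xs\<close> by (auto simp: in_set_conv_nth)
      define j where "j = Suc i mod ?k"
      define h where "h = (if i = 0 then ?k - 1 else i - 1)"
      have j: "j < ?k" unfolding j_def using i by (intro mod_less_divisor) linarith
      have h: "h < ?k" unfolding h_def using i by auto
      have hi: "Suc h mod ?k = i" using k i by (auto simp: h_def)
      have "h \<noteq> j" using k i by (cases "Suc i = ?k") (auto simp: h_def j_def split: if_splits)
      then have ne: "xs ! h \<noteq> xs ! j" using d j h by (simp add: nth_eq_iff_index_eq)
      have "adjacent G x (xs ! j)" "adjacent G x (xs ! h)"
        using a[OF i(1)] sym[OF a[OF h]] hi i(2) by (simp_all add: j_def)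
      then have "{xs ! j, xs ! h} \<subseteq> neighbors G x" using s j h by (auto simp: neighbors_def)
      then have "x \<notin> L \<union> R" using nL nR ne by auto
      then show ?thesis using that s V by auto
    qed
    then have "card (set xs) \<le> card {0, 1::nat}" by (intro card_mono) auto
    then show False using k distinct_card[OF d] by simp
  qed
  have A: "{x \<in> verts G. \<not> is_leaf G x} = {0, 1}"
    unfolding V leaf using nin by blast
  have B: "{x \<in> neighbors G 0. is_leaf G x} = L"
    unfolding n0 by (auto simp: leaf L_def R_def)
  have C: "{x \<in> neighbors G 1. is_leaf G x} = R"
    unfolding n1 by (auto simp: leaf L_def R_def)
  have "card L = m" "card R = n" by (simp_all add: L_def R_def)
  moreover have "adjacent G 0 1" by (simp add: adj)
  ultimately have "\<exists>u v. u \<noteq> v \<and> {x \<in> verts G. \<not> is_leaf G x} = {u, v} \<and> adjacent G u v \<and>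
      card {x \<in> neighbors G u. is_leaf G x} = m \<and> card {x \<in> neighbors G v. is_leaf G x} = n"
    using A B C by (intro exI[of _ 0] exI[of _ 1] conjI) (assumption | simp only: zero_neq_one not_False_eq_True)+
  then have "is_bistar m n G"
    unfolding is_bistar_def is_tree_def using sg conn acyc by blast
  then show ?thesis ..
qed

end

theory Submission
  imports Defs
begin

text \<open>
  Two adjacent vertices \<open>u\<close>, \<open>v\<close> are the centers of a copy of \<open>B(m,n)\<close> in a graph as soon as
  \<open>u\<close> has \<open>m\<close> neighbours other than \<open>v\<close>, \<open>v\<close> has \<open>n\<close> neighbours other than \<open>u\<close>, and together they
  have \<open>m + n\<close> neighbours other than \<open>u\<close> and \<open>v\<close> (lemma \<open>disjoint_subsets_of_card\<close>). Suppose that a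
  2-coloring of the complete graph on \<open>2n + m + 1\<close> vertices has no such pair in either color.

  Then every vertex has at most \<open>n + m\<close>, hence at least \<open>n\<close>, neighbours in each color
  (\<open>deg_le\<close>, \<open>deg_ge\<close>): the neighbours of a vertex of larger red degree would have red degree at
  most \<open>m\<close>, so two of them are joined in blue, and their huge blue degrees give a blue bistar.
  As \<open>n > m\<close>, both ends of an edge thus have more than \<open>m\<close> neighbours in its color.
  Consequently, if \<open>uv\<close> is red and \<open>u\<close> has more than \<open>n\<close> red neighbours, the only obstruction
  left is that the red neighbourhoods cover at most \<open>m + n + 1\<close> vertices, that is, at least \<open>n\<close>
  vertices are joined to both \<open>u\<close> and \<open>v\<close> in blue (\<open>card_common_ge\<close>).

  Now fix any vertex \<open>u\<close>, with \<open>r\<close> red and \<open>b\<close> blue neighbours, \<open>r + b = 2n + m\<close>. Each of the \<open>r b\<close>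
  edges between them is either blue, and counted at its red end, or red, and counted at its blue
  end, so \<open>r b\<close> is the sum of the common neighbourhood sizes above over all edges at \<open>u\<close>
  (\<open>deg_times_deg\<close>). If \<open>r, b > n\<close>, this gives \<open>r b \<ge> n (r + b)\<close>, that is,
  \<open>(r - n) (b - n) \<ge> n\<^sup>2\<close>, which is absurd since both factors are at most \<open>m < n\<close>. If \<open>r = n\<close>, then
  \<open>b = n + m\<close> and the blue edges alone contribute \<open>n b = r b\<close>, while the red ones contribute
  something positive; the case \<open>b = n\<close> is the same.
\<close>

section \<open>Bistars in a 2-colored complete graph\<close>

lemma disjoint_subsets_of_card:
  assumes "finite A" "finite B" "m \<le> card A" "n \<le> card B" "m + n \<le> card (A \<union> B)"
  obtains L M where "L \<subseteq> A" "M \<subseteq> B" "L \<inter> M = {}" "card L = m" "card M = n"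
proof (cases "m \<le> card (A - B)")
  case True
  then obtain L where "L \<subseteq> A - B" "card L = m"
    by (meson obtain_subset_with_card_n)
  moreover obtain M where "M \<subseteq> B" "card M = n"
    using assms(4) by (meson obtain_subset_with_card_n)
  ultimately show thesis using that[of L M] by blast
next
  case False
  \<comment> \<open>Use up all of \<open>A - B\<close>, so that as few elements of \<open>B\<close> as possible are lost.\<close>
  have "card A = card (A - B) + card (A \<inter> B)"
    using assms(1) by (metis add.commute card_Int_Diff)
  then have "m - card (A - B) \<le> card (A \<inter> B)" using assms(3) by simp
  then obtain X where X: "X \<subseteq> A \<inter> B" "card X = m - card (A - B)"
    by (meson obtain_subset_with_card_n)
  have fX: "finite X" using X(1) assms(1) by (meson finite_Int finite_subset)
  have "card (A \<union> B) = card (A - B) + card B"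
    using assms(1,2) by (metis Diff_disjoint Int_commute Un_Diff_cancel2 card_Un_disjoint finite_Diff)
  moreover have "card (B - X) = card B - card X"
    using X(1) fX by (intro card_Diff_subset) auto
  ultimately have "n \<le> card (B - X)" using X(2) assms(5) False by linarith
  then obtain M where M: "M \<subseteq> B - X" "card M = n" by (meson obtain_subset_with_card_n)
  have "card ((A - B) \<union> X) = card (A - B) + card X"
    using X(1) fX assms(1) by (intro card_Un_disjoint) auto
  then have "card ((A - B) \<union> X) = m" using X(2) False by simp
  then show thesis using that[of "(A - B) \<union> X" M] X(1) M by blast
qed

locale edge_coloring =
  fixes V :: "'v set" and c :: "'v set \<Rightarrow> bool"
  assumes finite_V: "finite V"
begin

definition nbrs :: "bool \<Rightarrow> 'v \<Rightarrow> 'v set" where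
  "nbrs i x = {y \<in> V. y \<noteq> x \<and> c {x, y} = i}"

abbreviation deg :: "bool \<Rightarrow> 'v \<Rightarrow> nat" where
  "deg i x \<equiv> card (nbrs i x)"

definition bistar_centers :: "nat \<Rightarrow> nat \<Rightarrow> bool \<Rightarrow> 'v \<Rightarrow> 'v \<Rightarrow> bool" where
  "bistar_centers m n i u v \<longleftrightarrow> u \<in> V \<and> v \<in> nbrs i u \<and>
     m \<le> card (nbrs i u - {v}) \<and> n \<le> card (nbrs i v - {u}) \<and>
     m + n \<le> card ((nbrs i u \<union> nbrs i v) - {u, v})"

lemma finite_nbrs [simp]: "finite (nbrs i x)"
  using finite_V by (simp add: nbrs_def)

lemma nbrs_sym: "u \<in> V \<Longrightarrow> v \<in> nbrs i u \<Longrightarrow> u \<in> nbrs i v"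
  by (auto simp: nbrs_def insert_commute)

lemma nbrs_in_V: "v \<in> nbrs i u \<Longrightarrow> v \<in> V"
  by (simp add: nbrs_def)

lemma deg_add_deg:
  assumes "u \<in> V" shows "deg i u + deg (\<not> i) u = card V - 1"
proof -
  have "nbrs i u \<union> nbrs (\<not> i) u = V - {u}" by (auto simp: nbrs_def)
  moreover have "nbrs i u \<inter> nbrs (\<not> i) u = {}" by (auto simp: nbrs_def)
  ultimately have "deg i u + deg (\<not> i) u = card (V - {u})"
    by (metis card_Un_disjoint finite_nbrs)
  then show ?thesis using assms finite_V by simp
qed

lemma card_common_other_color:
  assumes "u \<in> V" "v \<in> nbrs i u"
  shows "card (nbrs (\<not> i) u \<inter> nbrs (\<not> i) v) + card (nbrs i u \<union> nbrs i v) = card V"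
proof -
  have "(nbrs (\<not> i) u \<inter> nbrs (\<not> i) v) \<union> (nbrs i u \<union> nbrs i v) = V"
    using assms by (auto simp: nbrs_def insert_commute)
  moreover have "(nbrs (\<not> i) u \<inter> nbrs (\<not> i) v) \<inter> (nbrs i u \<union> nbrs i v) = {}"
    by (auto simp: nbrs_def)
  ultimately show ?thesis by (metis card_Un_disjoint finite_Int finite_Un finite_nbrs)
qed

text \<open>Both centers lie in the union of the two neighbourhoods, which accounts for the \<open>2\<close>.\<close>

lemma bistar_centersI:
  assumes "u \<in> V" "v \<in> nbrs i u" "m + 1 \<le> deg i u" "n + 1 \<le> deg i v"
    and "m + n + 2 \<le> card (nbrs i u \<union> nbrs i v)"
  shows "bistar_centers m n i u v"
proof -
  have "u \<in> nbrs i v" "u \<noteq> v" using assms(1,2) nbrs_sym by (auto simp: nbrs_def)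
  moreover have "card ((nbrs i u \<union> nbrs i v) - {u, v}) = card (nbrs i u \<union> nbrs i v) - 2"
    using assms(2) \<open>u \<in> nbrs i v\<close> \<open>u \<noteq> v\<close> by (subst card_Diff_subset) auto
  ultimately show ?thesis
    using assms by (auto simp: bistar_centers_def card_Diff_singleton)
qed

text \<open>An edge between a neighbour \<open>v\<close> of \<open>u\<close> in color \<open>i\<close> and a neighbour \<open>w\<close> in the other color
  makes \<open>w\<close> a common neighbour of \<open>u\<close> and \<open>v\<close>, or \<open>v\<close> one of \<open>u\<close> and \<open>w\<close>, according to its color.\<close>

lemma deg_times_deg:
  "deg i u * deg (\<not> i) u =
     (\<Sum>v\<in>nbrs i u. card (nbrs (\<not> i) u \<inter> nbrs (\<not> i) v)) +
     (\<Sum>w\<in>nbrs (\<not> i) u. card (nbrs i u \<inter> nbrs i w))"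
proof -
  let ?A = "SIGMA v:nbrs i u. nbrs (\<not> i) u \<inter> nbrs (\<not> i) v"
  let ?B = "SIGMA w:nbrs (\<not> i) u. nbrs i u \<inter> nbrs i w"
  have "nbrs i u \<times> nbrs (\<not> i) u = ?A \<union> prod.swap ` ?B"
    by (auto simp: nbrs_def insert_commute image_iff)
  moreover have "?A \<inter> prod.swap ` ?B = {}"
    by (auto simp: nbrs_def insert_commute)
  moreover have "finite ?A" "finite ?B" by simp_all
  ultimately have "card (nbrs i u \<times> nbrs (\<not> i) u) = card ?A + card (prod.swap ` ?B)"
    by (simp add: card_Un_disjoint del: card_cartesian_product)
  moreover have "card (prod.swap ` ?B) = card ?B" by (intro card_image) simp
  ultimately show ?thesis by (simp add: card_cartesian_product)
qed

end

section \<open>Forcing a monochromatic bistar\<close>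

locale bistar_free_coloring = edge_coloring V c
  for V :: "'v set" and c :: "'v set \<Rightarrow> bool" +
  fixes m n :: nat
  assumes card_V: "card V = 2 * n + m + 1"
    and m_pos: "1 \<le> m" and m_less: "m + 2 \<le> n"
    and bistar_free: "\<not> bistar_centers m n i u v"
begin

lemma deg_add: "u \<in> V \<Longrightarrow> deg i u + deg (\<not> i) u = 2 * n + m"
  using deg_add_deg card_V by simp

lemma deg_le:
  assumes u: "u \<in> V" shows "deg i u \<le> n + m"
proof (rule ccontr)
  assume *: "\<not> deg i u \<le> n + m"
  have small: "deg i v \<le> m" if v: "v \<in> nbrs i u" for v
  proof (rule ccontr)
    assume "\<not> deg i v \<le> m"
    \<comment> \<open>\<open>u\<close> lies in the neighbourhood of \<open>v\<close> and so adds one more vertex to its own.\<close>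
    have "card (insert u (nbrs i u)) \<le> card (nbrs i v \<union> nbrs i u)"
      using nbrs_sym[OF u v] by (intro card_mono) auto
    moreover have "u \<notin> nbrs i u" by (simp add: nbrs_def)
    ultimately have "m + n + 2 \<le> card (nbrs i v \<union> nbrs i u)" using * by simp
    then have "bistar_centers m n i v u"
      using nbrs_in_V[OF v] nbrs_sym[OF u v] * \<open>\<not> deg i v \<le> m\<close> by (intro bistar_centersI) auto
    then show False using bistar_free by blast
  qed
  obtain v where v: "v \<in> nbrs i u" using * by fastforce
  \<comment> \<open>\<open>v\<close> has too few neighbours in color \<open>i\<close> to be joined in it to all others in \<open>nbrs i u\<close>.\<close>
  have "\<not> nbrs i u \<subseteq> insert v (nbrs i v)"
  proof
    assume "nbrs i u \<subseteq> insert v (nbrs i v)"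
    then have "deg i u \<le> card (insert v (nbrs i v))" by (intro card_mono) auto
    also have "\<dots> \<le> m + 1" using small[OF v] card_insert_le_m1[of "m + 1"] by simp
    finally show False using * m_less by simp
  qed
  then obtain w where w: "w \<in> nbrs i u" "w \<noteq> v" "w \<notin> nbrs i v" by blast
  have vV: "v \<in> V" and wV: "w \<in> V" using v w nbrs_in_V by auto
  have vw: "w \<in> nbrs (\<not> i) v" using w wV by (auto simp: nbrs_def)
  have big: "2 * n \<le> deg (\<not> i) v" "2 * n \<le> deg (\<not> i) w"
    using small[OF v] small[OF w(1)] deg_add[OF vV, of i] deg_add[OF wV, of i] by linarith+
  have "deg (\<not> i) v \<le> card (nbrs (\<not> i) v \<union> nbrs (\<not> i) w)" by (intro card_mono) auto
  then have "bistar_centers m n (\<not> i) v w"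
    using vV vw big m_less by (intro bistar_centersI) auto
  then show False using bistar_free by blast
qed

lemma deg_ge: "u \<in> V \<Longrightarrow> n \<le> deg i u"
  using deg_le[of u "\<not> i"] deg_add[of u i] by linarith

lemma card_common_ge:
  assumes u: "u \<in> V" and v: "v \<in> nbrs i u" and big: "n + 1 \<le> deg i u \<or> n + 1 \<le> deg i v"
  shows "n \<le> card (nbrs (\<not> i) u \<inter> nbrs (\<not> i) v)"
proof -
  have vV: "v \<in> V" using v nbrs_in_V by blast
  have "n \<le> deg i u" "n \<le> deg i v" using deg_ge u vV by auto
  then have "card (nbrs i u \<union> nbrs i v) \<le> m + n + 1"
    using big bistar_centersI[OF u v, of m n] bistar_centersI[OF vV nbrs_sym[OF u v], of m n]
      bistar_free m_less by (force simp: Un_commute not_less_eq_eq)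
  then show ?thesis using card_common_other_color[OF u v] card_V by linarith
qed

text \<open>If both endpoints have only \<open>n\<close> neighbours in the color of the edge, these cannot
  cover all \<open>2n + m + 1\<close> vertices.\<close>

lemma card_common_pos:
  assumes u: "u \<in> V" and v: "v \<in> nbrs i u"
  shows "1 \<le> card (nbrs (\<not> i) u \<inter> nbrs (\<not> i) v)"
proof (cases "n + 1 \<le> deg i u \<or> n + 1 \<le> deg i v")
  case True
  then show ?thesis using card_common_ge[OF u v] m_less by linarith
next
  case False
  then show ?thesis
    using card_common_other_color[OF u v] card_V card_Un_le[of "nbrs i u" "nbrs i v"] by linarith
qed

text \<open>At a vertex of degree exactly \<open>n\<close> in color \<open>i\<close>, the edges of the other color already
  exhaust the double count in \<open>deg_times_deg\<close>, while those of color \<open>i\<close> still contribute.\<close>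

lemma n_less_deg: "u \<in> V \<Longrightarrow> n < deg i u"
proof (rule ccontr)
  assume u: "u \<in> V" and "\<not> n < deg i u"
  then have d: "deg i u = n" "deg (\<not> i) u = n + m"
    using deg_ge[OF u, of i] deg_add[OF u, of i] by linarith+
  have "(\<Sum>v\<in>nbrs i u. 1) \<le> (\<Sum>v\<in>nbrs i u. card (nbrs (\<not> i) u \<inter> nbrs (\<not> i) v))"
    using card_common_pos[OF u] by (intro sum_mono) blast
  moreover have "(\<Sum>w\<in>nbrs (\<not> i) u. n) \<le> (\<Sum>w\<in>nbrs (\<not> i) u. card (nbrs i u \<inter> nbrs i w))"
    using card_common_ge[OF u, of _ "\<not> i"] d m_pos by (intro sum_mono) simp
  ultimately have "n + (n + m) * n \<le> n * (n + m)"
    using deg_times_deg[of i u] d by simp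
  then show False using m_less by (simp add: algebra_simps)
qed

lemma no_bistar_free_coloring: False
proof -
  obtain u where u: "u \<in> V" using card_V by fastforce
  define r where "r = deg True u"
  define b where "b = deg False u"
  have big: "n + 1 \<le> deg i u" for i using n_less_deg[OF u, of i] by simp
  have "(\<Sum>v\<in>nbrs True u. n) \<le> (\<Sum>v\<in>nbrs True u. card (nbrs False u \<inter> nbrs False v))"
    using card_common_ge[OF u, of _ True] big by (intro sum_mono) simp
  moreover have "(\<Sum>v\<in>nbrs False u. n) \<le> (\<Sum>v\<in>nbrs False u. card (nbrs True u \<inter> nbrs True v))"
    using card_common_ge[OF u, of _ False] big by (intro sum_mono) simp
  ultimately have rb: "r * n + b * n \<le> r * b"
    using deg_times_deg[of True u] by (simp add: r_def b_def)
  obtain x y where xy: "r = n + x" "b = n + y"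
    using deg_ge[OF u] by (metis r_def b_def le_iff_add)
  have "x \<le> m" "y \<le> m" using deg_le[OF u] xy r_def b_def by (metis add_le_cancel_left)+
  then have "x * y \<le> m * m" by (intro mult_mono) auto
  moreover have "m * m < n * n" using m_less by (intro mult_strict_mono) auto
  moreover have "n * n \<le> x * y" using rb unfolding xy by (simp add: algebra_simps)
  ultimately show False by simp
qed

end

lemma (in edge_coloring) ex_bistar_centers:
  assumes "card V = 2 * n + m + 1" "1 \<le> m" "m + 2 \<le> n"
  shows "\<exists>i u v. bistar_centers m n i u v"
proof (rule ccontr)
  assume "\<not> ?thesis"
  with assms interpret bistar_free_coloring V c m n by unfold_locales auto
  show False by (rule no_bistar_free_coloring)
qed

section \<open>Copies of the bistar\<close>

text \<open>By connectedness no leaf is joined to another leaf: those two would form a component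
  without the centers.\<close>

lemma is_bistar_structure:
  assumes "is_bistar m n G"
  obtains u v L M where "u \<noteq> v" "{u, v} \<inter> (L \<union> M) = {}" "L \<inter> M = {}" "finite L" "finite M"
    "card L = m" "card M = n" "verts G = {u, v} \<union> L \<union> M"
    "edges G \<subseteq> insert {u, v} ((\<lambda>x. {u, x}) ` L \<union> (\<lambda>x. {v, x}) ` M)"
proof -
  obtain u v where uv: "u \<noteq> v" and nl: "{x \<in> verts G. \<not> is_leaf G x} = {u, v}"
    and cL: "card {x \<in> neighbors G u. is_leaf G x} = m"
    and cM: "card {x \<in> neighbors G v. is_leaf G x} = n"
    using assms unfolding is_bistar_def by blast
  define L where "L = {x \<in> neighbors G u. is_leaf G x}"
  define M where "M = {x \<in> neighbors G v. is_leaf G x}"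
  have sg: "simple_graph G" and conn: "connected_graph G"
    using assms by (auto simp: is_bistar_def is_tree_def)
  have fin: "finite (verts G)" and e2: "edges G \<subseteq> [verts G]\<^bsup>2\<^esup>"
    using sg by (auto simp: simple_graph_def)
  have sym: "adjacent G y x" if "adjacent G x y" for x y
    using that by (simp add: adjacent_def insert_commute)
  have adjV: "x \<in> verts G" "y \<in> verts G" if "adjacent G x y" for x y
    using that e2 by (auto simp: adjacent_def nsets_def)
  have uV: "u \<in> verts G" "v \<in> verts G" "\<not> is_leaf G u" "\<not> is_leaf G v" using nl by auto
  have leaf_nbr: "y \<in> {u, v}" if x: "is_leaf G x" and xy: "adjacent G x y" for x y
  proof (rule ccontr)
    assume "y \<notin> {u, v}"
    then have y: "is_leaf G y" using nl adjV[OF xy] by auto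
    have only: "b = a'" if "is_leaf G a" "adjacent G a a'" "adjacent G a b" for a a' b
    proof -
      have "a' \<in> neighbors G a" "b \<in> neighbors G a" using that adjV by (auto simp: neighbors_def)
      then show ?thesis using that(1) by (auto simp: is_leaf_def card_1_singleton_iff)
    qed
    have "(adjacent G)\<^sup>*\<^sup>* x u" using conn adjV[OF xy] uV by (auto simp: connected_graph_def)
    then have "u \<in> {x, y}"
    proof (induction rule: rtranclp_induct)
      case (step a b)
      then show ?case using only[OF x xy] only[OF y sym[OF xy]] by auto
    qed simp
    then show False using x y uV by auto
  qed
  have disj: "L \<inter> M = {}"
  proof (rule ccontr)
    assume "L \<inter> M \<noteq> {}"
    then obtain x where "is_leaf G x" "adjacent G u x" "adjacent G v x"
      by (auto simp: L_def M_def neighbors_def)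
    then have "{u, v} \<subseteq> neighbors G x" "card (neighbors G x) = 1"
      using sym uV by (auto simp: neighbors_def is_leaf_def)
    then show False using uv by (auto simp: card_1_singleton_iff)
  qed
  have LM: "x \<in> L \<and> y = u \<or> x \<in> M \<and> y = v" if "is_leaf G x" "adjacent G x y" for x y
    using leaf_nbr[OF that] sym[OF that(2)] that(1)
    by (auto simp: L_def M_def neighbors_def is_leaf_def)
  have "x \<in> L \<union> M" if x: "is_leaf G x" for x
  proof -
    obtain y where "y \<in> neighbors G x" using x by (auto simp: is_leaf_def card_1_singleton_iff)
    then show ?thesis using LM[OF x] by (auto simp: neighbors_def)
  qed
  moreover have "L \<union> M \<subseteq> verts G" by (auto simp: L_def M_def neighbors_def)
  ultimately have verts: "verts G = {u, v} \<union> L \<union> M" using nl by blast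
  have "e \<in> insert {u, v} ((\<lambda>x. {u, x}) ` L \<union> (\<lambda>x. {v, x}) ` M)" if e: "e \<in> edges G" for e
  proof -
    obtain x y where xy: "e = {x, y}" "x \<noteq> y" "x \<in> verts G" "y \<in> verts G"
      using e e2 by (auto simp: nsets_def card_2_iff)
    have a: "adjacent G x y" "adjacent G y x" using e xy by (auto simp: adjacent_def insert_commute)
    consider "is_leaf G x" | "is_leaf G y" | "x \<in> {u, v}" "y \<in> {u, v}" using xy nl by blast
    then show ?thesis
    proof cases
      case 1
      then show ?thesis using LM[OF _ a(1)] xy(1) by (auto simp: insert_commute)
    next
      case 2
      then show ?thesis using LM[OF _ a(2)] xy(1) by auto
    next
      case 3
      then show ?thesis using xy by (auto simp: insert_commute)
    qed
  qed
  then have edges: "edges G \<subseteq> insert {u, v} ((\<lambda>x. {u, x}) ` L \<union> (\<lambda>x. {v, x}) ` M)"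
    by (rule subsetI)
  have fLM: "finite L" "finite M" using fin by (simp_all add: verts)
  have "{u, v} \<inter> (L \<union> M) = {}" using uV by (auto simp: L_def M_def)
  then show thesis
    by (rule that[OF uv _ disj fLM cL[folded L_def] cM[folded M_def] verts edges])
qed

lemma isomorphic_image:
  assumes "simple_graph G" "inj_on f (verts G)"
  shows "isomorphic G (SGraph (f ` verts G) ((`) f ` edges G))"
proof -
  have "{x, y} \<in> edges G \<longleftrightarrow> {f x, f y} \<in> (`) f ` edges G"
    if "x \<in> verts G" "y \<in> verts G" for x y
  proof
    assume "{x, y} \<in> edges G"
    then have "f ` {x, y} \<in> (`) f ` edges G" by (rule imageI)
    then show "{f x, f y} \<in> (`) f ` edges G" by simp
  next
    assume "{f x, f y} \<in> (`) f ` edges G"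
    then obtain e where e: "e \<in> edges G" "f ` {x, y} = f ` e"
      by (elim imageE) simp
    then have "e \<subseteq> verts G" using assms(1) by (auto simp: simple_graph_def nsets_def)
    then have "e = {x, y}" using e(2) that inj_on_image_eq_iff[OF assms(2), of "{x, y}" e] by auto
    then show "{x, y} \<in> edges G" using e(1) by simp
  qed
  then show ?thesis
    using assms(2) unfolding isomorphic_def adjacent_def
    by (intro exI[of _ f]) (auto simp: bij_betw_def)
qed

lemma simple_graph_image:
  assumes "simple_graph G" "inj_on f (verts G)"
  shows "simple_graph (SGraph (f ` verts G) ((`) f ` edges G))"
proof -
  have "f ` e \<in> [f ` verts G]\<^bsup>2\<^esup>" if "e \<in> edges G" for e
  proof -
    have e: "e \<subseteq> verts G" "finite e" "card e = 2"
      using that assms(1) by (auto simp: simple_graph_def nsets_def)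
    then have "card (f ` e) = 2" using assms(2) by (metis card_image inj_on_subset)
    then show ?thesis using e by (auto simp: nsets_def)
  qed
  then show ?thesis using assms(1) by (auto simp: simple_graph_def)
qed

lemma bistar_copy:
  assumes G: "is_bistar m n G"
    and W: "u \<noteq> v" "{u, v} \<inter> (L \<union> M) = {}" "L \<inter> M = {}" "finite L" "finite M"
      "card L = m" "card M = n"
  obtains H where "isomorphic G H" "simple_graph H" "verts H = {u, v} \<union> L \<union> M"
    "edges H \<subseteq> insert {u, v} ((\<lambda>x. {u, x}) ` L \<union> (\<lambda>x. {v, x}) ` M)"
proof -
  obtain a b A B where S: "a \<noteq> b" "{a, b} \<inter> (A \<union> B) = {}" "A \<inter> B = {}" "finite A" "finite B"
      "card A = m" "card B = n" "verts G = {a, b} \<union> A \<union> B"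
      "edges G \<subseteq> insert {a, b} ((\<lambda>x. {a, x}) ` A \<union> (\<lambda>x. {b, x}) ` B)"
    using is_bistar_structure[OF G] by metis
  obtain g h where g: "bij_betw g A L" and h: "bij_betw h B M"
    using S W by (metis finite_same_card_bij)
  define f where "f x = (if x = a then u else if x = b then v else if x \<in> A then g x else h x)" for x
  have fa: "f a = u" "f b = v" using S(1) by (auto simp: f_def)
  have fA: "f x = g x" if "x \<in> A" for x using that S(2) by (auto simp: f_def)
  have fB: "f x = h x" if "x \<in> B" for x using that S(2,3) by (auto simp: f_def)
  have "bij_betw f {a, b} {u, v}" using fa S(1) W(1) by (auto simp: bij_betw_def)
  moreover have "bij_betw f A L" using g fA by (simp cong: bij_betw_cong)
  moreover have "bij_betw f B M" using h fB by (simp cong: bij_betw_cong)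
  ultimately have bij: "bij_betw f (verts G) ({u, v} \<union> L \<union> M)"
    unfolding S(8) using W(2,3) by (intro bij_betw_combine) auto
  have sg: "simple_graph G" using G by (auto simp: is_bistar_def is_tree_def)
  have inj: "inj_on f (verts G)" and img: "f ` verts G = {u, v} \<union> L \<union> M"
    using bij by (auto simp: bij_betw_def)
  have gL: "g x \<in> L" if "x \<in> A" for x using that g by (auto simp: bij_betw_def)
  have hM: "h x \<in> M" if "x \<in> B" for x using that h by (auto simp: bij_betw_def)
  have "(`) f ` edges G \<subseteq> insert {u, v} ((\<lambda>x. {u, x}) ` L \<union> (\<lambda>x. {v, x}) ` M)"
  proof
    fix e assume "e \<in> (`) f ` edges G"
    then obtain d where d: "d \<in> edges G" "e = f ` d" by (rule imageE)
    consider "d = {a, b}" | x where "x \<in> A" "d = {a, x}" | x where "x \<in> B" "d = {b, x}"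
      using subsetD[OF S(9) d(1)] by blast
    then show "e \<in> insert {u, v} ((\<lambda>x. {u, x}) ` L \<union> (\<lambda>x. {v, x}) ` M)"
    proof cases
      case 1
      then show ?thesis using fa d(2) by simp
    next
      case (2 x)
      then have "e = {u, g x}" using fa fA d(2) by simp
      then show ?thesis using gL[OF 2(1)] by blast
    next
      case (3 x)
      then have "e = {v, h x}" using fa fB d(2) by simp
      then show ?thesis using hM[OF 3(1)] by blast
    qed
  qed
  with isomorphic_image[OF sg inj] simple_graph_image[OF sg inj] img show thesis
    by (intro that[of "SGraph (f ` verts G) ((`) f ` edges G)"]) simp_all
qed

theorem proposition3p4:
  fixes m n :: nat and B :: "'a sgraph"
  assumes "m \<ge> 3" and "m + 2 \<le> n" and "n \<le> 2 * m - 1"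
    and "is_bistar m n B"
  shows "ramsey_number B \<le> 2 * n + m + 1"
proof -
  define r where "r = 2 * n + m + 1"
  have "ramsey_arrows r B"
    unfolding ramsey_arrows_def
  proof
    fix c assume c: "c \<in> edges (complete_graph r) \<rightarrow> {..<2::nat}"
    \<comment> \<open>\<open>True\<close> stands for color \<open>0\<close> and \<open>False\<close> for color \<open>1\<close>.\<close>
    interpret edge_coloring "{..<r}" "\<lambda>e. c e = 0" by unfold_locales simp
    obtain i u v where "bistar_centers m n i u v"
      using ex_bistar_centers[of n m] assms by (auto simp: r_def)
    then have u: "u < r" and v: "v \<in> nbrs i u" and card: "m \<le> card (nbrs i u - {v})"
        "n \<le> card (nbrs i v - {u})" "m + n \<le> card ((nbrs i u \<union> nbrs i v) - {u, v})"
      by (auto simp: bistar_centers_def)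
    have "(nbrs i u - {v}) \<union> (nbrs i v - {u}) = (nbrs i u \<union> nbrs i v) - {u, v}"
      by (auto simp: nbrs_def)
    then obtain L M where LM: "L \<subseteq> nbrs i u - {v}" "M \<subseteq> nbrs i v - {u}" "L \<inter> M = {}"
        "card L = m" "card M = n"
      using disjoint_subsets_of_card[of "nbrs i u - {v}" "nbrs i v - {u}" m n] card
      by (metis finite_Diff finite_nbrs)
    have fin: "finite L" "finite M"
      using LM(1,2) by (auto intro: finite_subset[OF _ finite_nbrs])
    have uv: "u \<noteq> v" "{u, v} \<inter> (L \<union> M) = {}" using v LM(1,2) by (auto simp: nbrs_def)
    obtain H where H: "isomorphic B H" "simple_graph H" "verts H = {u, v} \<union> L \<union> M"
        "edges H \<subseteq> insert {u, v} ((\<lambda>x. {u, x}) ` L \<union> (\<lambda>x. {v, x}) ` M)"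
      using bistar_copy[OF assms(4) uv LM(3) fin LM(4,5)] .
    have V: "verts H \<subseteq> {..<r}" using H(3) u v LM(1,2) by (auto simp: nbrs_def)
    then have E: "edges H \<subseteq> edges (complete_graph r)"
      using H(2) by (auto simp: simple_graph_def complete_graph_def nsets_def)
    have mono: "(c e = 0) = i" if "e \<in> edges H" for e
      using subsetD[OF H(4) that] v LM(1,2) by (auto simp: nbrs_def)
    have "c e = (if i then 0 else 1)" if "e \<in> edges H" for e
    proof -
      have "c e < 2" using c E that by auto
      then show ?thesis using mono[OF that] by auto
    qed
    then have "\<exists>k<2. \<forall>e\<in>edges H. c e = k" by (intro exI[of _ "if i then 0 else 1"]) auto
    then show "\<exists>H. subgraph H (complete_graph r) \<and> (\<exists>k<2. \<forall>e\<in>edges H. c e = k) \<and> isomorphic B H"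
      using H(1,2) V E
      by (intro exI[of _ H]) (simp add: subgraph_def complete_graph_def)
  qed
  then show ?thesis unfolding ramsey_number_def r_def by (rule Least_le)
qed

end
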